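(* Let $Q(x,y)=ax^2+bxy+cy^2$ be a primitive positive definite integral binary quadratic form and let $\Delta=b^2-4ac$. Then $\kappa_Q$ depends only on $\Delta$ and is given as follows. (i) If $4\mid\Delta$, write $\Delta=-2^nm$ with $n\ge2$ and $m$ positive and odd; when $m>1$, let $p_{\min}$ be the smallest odd prime divisor of $\Delta$. Then \[ \kappa_Q=\begin{cases}8 & \text{if }m=1\text{ and }n=3,\\ 4 & \text{if }m=1\text{ and }n\ne3,\\ \min\{8,p_{\min}\} & \text{if }m\ne1\text{ and }n=3,\\ \min\{4,p_{\min}\} & \text{if }m\neq1\text{ and }n\ne3.\end{cases} \] (ii) If $\Delta\equiv1\pmod4$, set $p_{\min}:=\min\{p\mid p\text{ is an odd prime divisor of }\Delta\}$ and $q_{\min}:=\min\{q\text{ odd prime}\mid \left(\frac{\Delta}{q}\right)=-1\}$, where $\left(\frac{\cdot}{\cdot}\right)$ is the Legendre symbol. Then \[ \kappa_Q=\begin{cases}3 & \text{if }3\mid\Delta,\\ 4 & \text{if }3\nmid\Delta\text{ and }\Delta\equiv5\pmod8,\\ \min\{p_{\min},q_{\min}^2\} & \text{if }3\nmid\Delta\text{ and }\Delta\equiv1\pmod8.\end{cases} \]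
   Context: An integral binary quadratic form $Q(x,y)=ax^2+bxy+cy^2$ has $a,b,c\in\mathbb{Z}$; it is primitive if $\gcd(a,b,c)=1$. For $l\in\mathbb{Z}$ and $k\in\mathbb{Z}_{\ge1}$, write $Q\not\equiv l\pmod k$ if $Q(x,y)\not\equiv l\pmod k$ for all $(x,y)\in\mathbb{Z}^2$. We say $Q$ has a local obstruction modulo $k$ if there exists $l\in\mathbb{Z}$ with $Q\not\equiv l\pmod k$. The minimal obstruction modulus is $\kappa_Q:=\min\{k\in\mathbb{Z}_{\ge1}\mid Q\text{ has a local obstruction modulo }k\}$, with $\kappa_Q=\infty$ if $Q$ has no local obstruction. *)

theory Defs
  imports "HOL-Number_Theory.Number_Theory" "HOL-Library.Extended_Nat"
begin

definition bqf :: "int \<Rightarrow> int \<Rightarrow> int \<Rightarrow> int \<Rightarrow> int \<Rightarrow> int" where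
  "bqf a b c x y = a * x\<^sup>2 + b * x * y + c * y\<^sup>2"

definition primitive_bqf :: "int \<Rightarrow> int \<Rightarrow> int \<Rightarrow> bool" where
  "primitive_bqf a b c \<longleftrightarrow> Gcd {a, b, c} = 1"

definition pos_def_bqf :: "int \<Rightarrow> int \<Rightarrow> int \<Rightarrow> bool" where
  "pos_def_bqf a b c \<longleftrightarrow> (\<forall>x y. (x, y) \<noteq> (0, 0) \<longrightarrow> bqf a b c x y > 0)"

definition discr_bqf :: "int \<Rightarrow> int \<Rightarrow> int \<Rightarrow> int" where
  "discr_bqf a b c = b\<^sup>2 - 4 * a * c"

definition has_local_obstruction :: "(int \<Rightarrow> int \<Rightarrow> int) \<Rightarrow> nat \<Rightarrow> bool" where
  "has_local_obstruction Q k \<longleftrightarrow> (\<exists>l. \<forall>x y. \<not> [Q x y = l] (mod int k))"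

(* The infimum in enat of a nonempty set is its minimum, and Inf {} = \<infinity>. *)
definition min_obstruction_modulus :: "(int \<Rightarrow> int \<Rightarrow> int) \<Rightarrow> enat" where
  "min_obstruction_modulus Q = Inf (enat ` {k. k \<ge> 1 \<and> has_local_obstruction Q k})"

(* LEAST is unspecified if no such prime exists; for a negative D this happens only for
   D = -(2 ^ k). *)
definition p_min :: "int \<Rightarrow> nat" where
  "p_min D = (LEAST p. prime p \<and> odd p \<and> int p dvd D)"

(* LEAST is unspecified if no such prime exists, but for a negative D there always is one. *)
definition q_min :: "int \<Rightarrow> nat" where
  "q_min D = (LEAST q. prime q \<and> odd q \<and> Legendre D (int q) = -1)"

end

theory Submission
  imports Defs
begin

text \<open>By the Chinese remainder theorem the least obstructed modulus is a prime power, so it suffices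
  to decide obstruction modulo \<open>p ^ e\<close>. If an odd prime \<open>p\<close> divides the discriminant \<open>\<Delta>\<close>, the form
  is a multiple of a square modulo \<open>p\<close> and is obstructed there. If \<open>p\<close> does not divide \<open>\<Delta>\<close>,
  the gradient vanishes modulo \<open>p\<close> only at the origin, so nontrivial solutions modulo \<open>p\<close> lift: the form
  is onto modulo \<open>p\<close>, onto modulo all \<open>p ^ e\<close> if \<open>\<Delta>\<close> is a residue, and misses \<open>p\<close> modulo
  \<open>p\<^sup>2\<close> otherwise. Modulo 4 and 8 with \<open>4 dvd \<Delta>\<close>, multiplying by an odd outer coefficient turns the form
  into \<open>u\<^sup>2 - (\<Delta> / 4) v\<^sup>2\<close>.\<close>

section \<open>The Jacobi symbol and inert primes\<close>

lemma Legendre_values: "Legendre a p \<in> {-1, 0, 1}"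
  by (simp add: Legendre_def)

lemma Legendre_cong:
  assumes "[a = b] (mod p)"
  shows "Legendre a p = Legendre b p"
proof -
  have "[a = 0] (mod p) \<longleftrightarrow> [b = 0] (mod p)"
    using assms cong_sym cong_trans by blast
  moreover have "QuadRes p a \<longleftrightarrow> QuadRes p b"
    unfolding QuadRes_def using assms cong_sym cong_trans by blast
  ultimately show ?thesis by (simp add: Legendre_def)
qed

text \<open>Two elements of \<open>{-1, 0, 1}\<close> differ by at most 2, so a congruence modulo
  \<open>p > 2\<close> is an equality. This turns Euler's criterion into exact identities.\<close>

lemma Legendre_eqI:
  assumes "[Legendre a p = x] (mod p)" "x \<in> {-1, 0, 1}" "p > 2"
  shows "Legendre a p = x"
proof -
  have "p dvd Legendre a p - x"
    using assms(1) by (simp add: cong_iff_dvd_diff)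
  moreover have "\<bar>Legendre a p - x\<bar> < p"
    using Legendre_values[of a p] assms(2,3) by auto
  ultimately show ?thesis
    using zdvd_not_zless[of "Legendre a p - x" p] zdvd_not_zless[of "x - Legendre a p" p]
      dvd_diff_commute by fastforce
qed

text \<open>By Euler's criterion the symbol is congruent to a power of its argument, and powers are
  multiplicative.\<close>

lemma Legendre_mult:
  assumes "prime p" "p > 2"
  shows "Legendre (a * b) (int p) = Legendre a (int p) * Legendre b (int p)"
proof (rule Legendre_eqI)
  have "[Legendre (a * b) (int p) = (a * b) ^ ((p - 1) div 2)] (mod int p)"
    using euler_criterion assms by blast
  moreover have "[Legendre a (int p) * Legendre b (int p) = a ^ ((p - 1) div 2) * b ^ ((p - 1) div 2)] (mod int p)"
    using euler_criterion assms by (intro cong_mult) blast+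
  ultimately show "[Legendre (a * b) (int p) = Legendre a (int p) * Legendre b (int p)] (mod int p)"
    by (metis cong_sym cong_trans power_mult_distrib)
  show "Legendre a (int p) * Legendre b (int p) \<in> {-1, 0, 1}"
    using Legendre_values[of a "int p"] Legendre_values[of b "int p"] by auto
qed (use assms in simp)

section \<open>The Jacobi symbol\<close>

text \<open>The product runs over the multiset of prime factors, so repeated primes count and
  \<open>jacobi_mult_right\<close> is immediate.\<close>

definition jacobi :: "int \<Rightarrow> nat \<Rightarrow> int" where
  "jacobi a n = (\<Prod>p\<in>#prime_factorization n. Legendre a (int p))"

lemma jacobi_1_right [simp]: "jacobi a (Suc 0) = 1"
  by (simp add: jacobi_def)

lemma jacobi_prime: "prime p \<Longrightarrow> jacobi a p = Legendre a (int p)"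
  by (simp add: jacobi_def prime_factorization_prime)

lemma jacobi_mult_right:
  assumes "m > 0" "n > 0"
  shows "jacobi a (m * n) = jacobi a m * jacobi a n"
  using assms by (simp add: jacobi_def prime_factorization_mult)

lemma odd_prime_gt_2: "prime (p::nat) \<Longrightarrow> odd p \<Longrightarrow> p > 2"
  using prime_ge_2_nat[of p] by (cases "p = 2") auto

lemma odd_prime_factor_gt_2:
  fixes p n :: nat
  assumes "odd n" "p \<in># prime_factorization n"
  shows "prime p" "p > 2"
proof -
  show "prime p" using assms(2) by auto
  moreover have "odd p" using assms(1) dvd_trans[OF _ in_prime_factors_imp_dvd[OF assms(2)], of 2] by blast
  ultimately show "p > 2" by (rule odd_prime_gt_2)
qed

lemma jacobi_mult_left:
  assumes "odd n"
  shows "jacobi (a * b) n = jacobi a n * jacobi b n"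
proof -
  have "jacobi (a * b) n = (\<Prod>p\<in>#prime_factorization n. Legendre a (int p) * Legendre b (int p))"
    unfolding jacobi_def
    by (intro arg_cong[where f = prod_mset] image_mset_cong)
      (use odd_prime_factor_gt_2[OF assms] in \<open>auto simp: Legendre_mult\<close>)
  then show ?thesis by (simp add: jacobi_def prod_mset.distrib)
qed

lemma jacobi_cong:
  assumes "[a = b] (mod int n)"
  shows "jacobi a n = jacobi b n"
  unfolding jacobi_def
proof (intro arg_cong[where f = prod_mset] image_mset_cong Legendre_cong)
  fix p assume "p \<in># prime_factorization n"
  then show "[a = b] (mod int p)"
    using assms cong_dvd_modulus by (meson in_prime_factors_imp_dvd int_dvd_int_iff)
qed

text \<open>Adjoins one odd prime at a time; this is how laws for prime moduli extend to the Jacobi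
  symbol.\<close>

lemma odd_nat_induct [consumes 1, case_names one prime_factor]:
  fixes n :: nat
  assumes "odd n"
    and "P (Suc 0)"
    and "\<And>p n. prime p \<Longrightarrow> odd p \<Longrightarrow> odd n \<Longrightarrow> P n \<Longrightarrow> P (p * n)"
  shows "P n"
  using assms(1)
proof (induction n rule: prime_divisors_induct)
  case (unit x)
  then show ?case using assms(2) by simp
next
  case (factor p x)
  then show ?case using assms(3) by simp
qed simp

lemma jacobi_1_left:
  assumes "odd n"
  shows "jacobi 1 n = 1"
  using assms
proof (induction n rule: odd_nat_induct)
  case (prime_factor p n)
  have "QuadRes (int p) 1"
    unfolding QuadRes_def by (rule exI[of _ 1]) simp
  moreover have "\<not> [1 = 0] (mod int p)"
    using prime_factor by (simp add: cong_0_iff prime_nat_iff)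
  ultimately show ?case
    using prime_factor by (simp add: jacobi_mult_right odd_pos jacobi_prime Legendre_def)
qed simp

section \<open>Quadratic reciprocity for odd moduli\<close>

text \<open>For odd arguments this is the sign
  \<open>(-1) ^ ((m - 1) div 2 * ((n - 1) div 2))\<close> of quadratic reciprocity, written through
  residues modulo 4 so that multiplicativity is a finite check.\<close>

definition recip_sign :: "nat \<Rightarrow> nat \<Rightarrow> int" where
  "recip_sign m n = (if m mod 4 = 3 \<and> n mod 4 = 3 then -1 else 1)"

lemma odd_nat_mod_4: "odd (n::nat) \<Longrightarrow> n mod 4 = 1 \<or> n mod 4 = 3"
  by presburger

lemma recip_sign_mult_left:
  assumes "odd m" "odd m'"
  shows "recip_sign (m * m') n = recip_sign m n * recip_sign m' n"
  using odd_nat_mod_4[OF assms(1)] odd_nat_mod_4[OF assms(2)]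
  by (auto simp: recip_sign_def mod_mult_eq[of m 4 m', symmetric])

lemma recip_sign_commute: "recip_sign m n = recip_sign n m"
  by (auto simp: recip_sign_def)

lemma minus_one_power_half:
  "odd p \<Longrightarrow> (-1) ^ ((p - 1) div 2) = (if p mod 4 = 3 then -1 else 1 :: int)"
proof -
  assume "odd p"
  then have "even ((p - 1) div 2) \<longleftrightarrow> p mod 4 \<noteq> 3" by presburger
  then show ?thesis by simp
qed

lemma jacobi_minus_one:
  assumes "odd n"
  shows "jacobi (-1) n = (if n mod 4 = 3 then -1 else 1)"
  using assms
proof (induction n rule: odd_nat_induct)
  case (prime_factor p n)
  have "Legendre (-1) (int p) = (if p mod 4 = 3 then -1 else 1)"
    using euler_criterion[of p "-1"] odd_prime_gt_2[of p] prime_factor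
      minus_one_power_half[of p]
    by (intro Legendre_eqI) auto
  \<comment> \<open>The claimed value is \<open>recip_sign n 3\<close>, so multiplicativity of the
    sign completes the induction.\<close>
  then show ?case
    using recip_sign_mult_left[of p n 3] prime_factor
    by (auto simp: jacobi_mult_right odd_pos jacobi_prime recip_sign_def split: if_splits)
qed simp

text \<open>For distinct primes the product of the two symbols is a sign, so both are 1 or -1 and
  either may be moved across; for \<open>p = q\<close> both vanish.\<close>

lemma Legendre_reciprocity:
  assumes "prime p" "odd p" "prime q" "odd q"
  shows "Legendre (int p) (int q) = recip_sign p q * Legendre (int q) (int p)"
proof (cases "p = q")
  case True
  then show ?thesis by (simp add: Legendre_def cong_0_iff)
next
  case False
  note gt = odd_prime_gt_2[OF assms(1,2)] odd_prime_gt_2[OF assms(3,4)]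
  have "Legendre p q * Legendre q p = ((-1) ^ ((p - 1) div 2)) ^ ((q - 1) div 2)"
    using Quadratic_Reciprocity[of p q] assms gt False by (simp add: power_mult)
  also have "\<dots> = recip_sign p q"
    using minus_one_power_half[OF assms(2)] minus_one_power_half[OF assms(4)]
    by (auto simp: recip_sign_def)
  finally show ?thesis
    using Legendre_values[of p q] Legendre_values[of q p]
    by (auto simp: recip_sign_def split: if_splits)
qed

text \<open>Both sides are multiplicative in \<open>m\<close> and in \<open>n\<close>, so an
  induction on the prime factors of \<open>m\<close>, with an inner one on those of
  \<open>n\<close>, reduces the law to primes.\<close>

lemma jacobi_reciprocity:
  assumes "odd m" "odd n"
  shows "jacobi (int m) n = recip_sign m n * jacobi (int n) m"
  using assms(1)
proof (induction m rule: odd_nat_induct)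
  case one
  then show ?case by (simp add: jacobi_1_left assms recip_sign_def)
next
  case (prime_factor p m)
  have "jacobi (int p) n = recip_sign p n * Legendre (int n) (int p)"
    using assms(2)
  proof (induction n rule: odd_nat_induct)
    case one
    have "jacobi 1 p = 1" using prime_factor jacobi_1_left by simp
    then show ?case using prime_factor
      by (simp add: recip_sign_def jacobi_prime)
  next
    case (prime_factor q n)
    then show ?case using \<open>prime p\<close> \<open>odd p\<close>
      by (simp add: jacobi_mult_right odd_pos jacobi_prime Legendre_reciprocity[of p q]
          recip_sign_commute[of p] recip_sign_mult_left Legendre_mult odd_prime_gt_2)
  qed
  then show ?case using prime_factor assms(2)
    by (simp add: jacobi_mult_right jacobi_mult_left odd_pos jacobi_prime recip_sign_mult_left)
qed

text \<open>With \<open>D = -d\<close>, the modulus \<open>N = 2 * d - 1\<close> is congruent to \<open>1\<close> modulo \<open>4\<close> and to \<open>-1\<close> modulo \<open>d\<close>,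
  so reciprocity evaluates the Jacobi symbol of \<open>D\<close> modulo \<open>N\<close> to \<open>-1\<close>.\<close>

lemma ex_prime_Legendre_minus_one:
  fixes D :: int
  assumes "D < 0" "[D = 1] (mod 4)"
  shows "\<exists>q. prime q \<and> odd q \<and> Legendre D (int q) = -1"
proof -
  define d where "d = nat (- D)"
  define N where "N = 2 * d - 1"
  have D: "D = - int d" using assms by (simp add: d_def)
  have "d mod 4 = 3" using assms(2) unfolding D cong_iff_dvd_diff by presburger
  then obtain k where k: "d = 4 * k + 3" by (metis mult_div_mod_eq)
  then have "N = 4 * (2 * k + 1) + 1" by (simp add: N_def)
  moreover from this have "N mod 4 = 1" by presburger
  ultimately have odds: "odd d" "odd N" "N mod 4 = 1" "d > 0" using k by simp_all
  have "int N = 2 * int d - 1" using odds by (simp add: N_def of_nat_diff)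
  then have "[int N = -1] (mod int d)" by (simp add: cong_iff_dvd_diff)
  have "jacobi D N = jacobi (-1) N * jacobi (int d) N"
    using jacobi_mult_left[of N "-1" "int d"] odds by (simp add: D)
  \<comment> \<open>As \<open>N mod 4 = 1\<close>, both \<open>jacobi (-1) N\<close> and the sign of
    reciprocity are 1.\<close>
  also have "\<dots> = jacobi (int N) d"
    using odds by (simp add: jacobi_minus_one jacobi_reciprocity[of d N] recip_sign_def)
  also have "\<dots> = jacobi (-1) d" by (rule jacobi_cong) fact
  also have "\<dots> = -1" using odds \<open>d mod 4 = 3\<close> by (simp add: jacobi_minus_one)
  finally have J: "jacobi D N = -1" .
  \<comment> \<open>A product of nonnegative symbols cannot be -1, so some prime factor of
    \<open>N\<close> has symbol -1.\<close>
  have "\<exists>q\<in>#prime_factorization N. Legendre D (int q) = -1"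
  proof (rule ccontr)
    assume "\<not> ?thesis"
    then have nonneg: "Legendre D (int q) \<ge> 0" if "q \<in># prime_factorization N" for q
      using Legendre_values[of D "int q"] that by auto
    have "(\<Prod>q\<in>#M. Legendre D (int q)) \<ge> 0"
      if "set_mset M \<subseteq> set_mset (prime_factorization N)" for M
      using that by (induction M) (simp_all add: nonneg)
    then have "jacobi D N \<ge> 0" by (simp add: jacobi_def)
    with J show False by simp
  qed
  then obtain q where "q \<in># prime_factorization N" "Legendre D (int q) = -1" by blast
  moreover from this odd_prime_factor_gt_2[OF \<open>odd N\<close>] have "prime q" "q > 2" by blast+
  ultimately show ?thesis using prime_odd_nat by blast
qed

section \<open>Obstructions at odd primes\<close>

lemma bqf_cong:
  assumes "[x = x'] (mod k)" "[y = y'] (mod k)"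
  shows "[bqf a b c x y = bqf a b c x' y'] (mod k)"
  unfolding bqf_def using assms by (intro cong_add cong_mult cong_pow cong_refl)

text \<open>If \<open>l\<close> is represented modulo \<open>m\<close> and modulo \<open>n\<close>,
  the Chinese remainder theorem in each coordinate glues the two representations into one modulo
  \<open>m * n\<close>.\<close>

lemma has_local_obstruction_coprime_mult:
  assumes "coprime m n" "has_local_obstruction (bqf a b c) (m * n)"
  shows "has_local_obstruction (bqf a b c) m \<or> has_local_obstruction (bqf a b c) n"
proof (rule ccontr)
  assume neg: "\<not> ?thesis"
  obtain l where l: "\<And>x y. \<not> [bqf a b c x y = l] (mod int (m * n))"
    using assms(2) unfolding has_local_obstruction_def by blast
  obtain x1 y1 x2 y2 where
    1: "[bqf a b c x1 y1 = l] (mod int m)" and 2: "[bqf a b c x2 y2 = l] (mod int n)"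
    using neg unfolding has_local_obstruction_def by blast
  have cop: "coprime (int m) (int n)" using assms(1) by simp
  obtain x where x: "[x = x1] (mod int m)" "[x = x2] (mod int n)"
    using binary_chinese_remainder_int[OF cop] by blast
  obtain y where y: "[y = y1] (mod int m)" "[y = y2] (mod int n)"
    using binary_chinese_remainder_int[OF cop] by blast
  have "[bqf a b c x y = l] (mod int m)" "[bqf a b c x y = l] (mod int n)"
    using bqf_cong[OF x(1) y(1)] bqf_cong[OF x(2) y(2)] 1 2 cong_trans by blast+
  then have "[bqf a b c x y = l] (mod int m * int n)"
    using coprime_cong_mult cop by blast
  with l show False by simp
qed

text \<open>A smaller modulus above 1 splits as \<open>p ^ e * r\<close> with \<open>r\<close> prime
  to \<open>p\<close> and smaller still, so strong induction leaves only prime powers to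
  check.\<close>

lemma min_obstruction_modulus_eqI:
  assumes "has_local_obstruction (bqf a b c) K" "K > 0"
    and prime_powers: "\<And>p e. prime p \<Longrightarrow> e > 0 \<Longrightarrow> p ^ e < K \<Longrightarrow>
      \<not> has_local_obstruction (bqf a b c) (p ^ e)"
  shows "min_obstruction_modulus (bqf a b c) = enat K"
proof -
  have no_obs: "\<not> has_local_obstruction (bqf a b c) k" if "k > 0" "k < K" for k
    using that
  proof (induction k rule: less_induct)
    case (less k)
    show ?case
    proof (cases "k = 1")
      case True
      then show ?thesis by (simp add: has_local_obstruction_def)
    next
      case False
      then obtain p where "prime p" "p dvd k" using prime_factor_nat by blast
      then obtain p e r where p: "prime p" "\<not> p dvd r" "e > 0" "k = p ^ e * r"
        using divide_out_primepow_ex[of k "\<lambda>_. True"] less.prems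
        by (metis bot_nat_0.not_eq_extremum prime_factors_dvd mem_Collect_eq in_prime_factors_iff)
      have "r > 0" using p less.prems by (cases r) auto
      have "p ^ e > 1" using p prime_gt_1_nat one_less_power by blast
      then have "r < k" using p \<open>r > 0\<close> by simp
      have "p ^ e \<le> k" using p \<open>r > 0\<close> by simp
      have "coprime (p ^ e) r" using p by (simp add: prime_imp_coprime)
      moreover have "\<not> has_local_obstruction (bqf a b c) r"
        using less \<open>r > 0\<close> \<open>r < k\<close> by simp
      moreover have "\<not> has_local_obstruction (bqf a b c) (p ^ e)"
        using prime_powers[OF p(1,3)] le_less_trans[OF \<open>p ^ e \<le> k\<close>] less.prems by blast
      ultimately show ?thesis
        using has_local_obstruction_coprime_mult p(4) by blast
    qed
  qed
  show ?thesis unfolding min_obstruction_modulus_def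
  proof (rule antisym)
    show "Inf (enat ` {k. 1 \<le> k \<and> has_local_obstruction (bqf a b c) k}) \<le> enat K"
      using assms(1,2) by (intro Inf_lower) auto
    show "enat K \<le> Inf (enat ` {k. 1 \<le> k \<and> has_local_obstruction (bqf a b c) k})"
      using no_obs by (intro Inf_greatest) (fastforce simp: not_less[symmetric])
  qed
qed

section \<open>Symmetry, completing the square and lifting\<close>

lemma bqf_commute: "bqf a b c x y = bqf c b a y x"
  by (simp add: bqf_def algebra_simps)

lemma has_local_obstruction_bqf_commute:
  "has_local_obstruction (bqf a b c) k \<longleftrightarrow> has_local_obstruction (bqf c b a) k"
  unfolding has_local_obstruction_def using bqf_commute by metis

lemma discr_bqf_commute: "discr_bqf a b c = discr_bqf c b a"
  by (simp add: discr_bqf_def)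

lemma complete_square:
  "4 * a * bqf a b c x y = (2 * a * x + b * y)\<^sup>2 - discr_bqf a b c * y\<^sup>2"
  by (simp add: bqf_def discr_bqf_def power2_eq_square algebra_simps)

text \<open>A coefficient prime to \<open>p\<close> is invertible and the other variable is set to
  0; with \<open>v = 0\<close> this also serves to divide by a single unit.\<close>

lemma linear_cong_solvable:
  fixes p :: int
  assumes "prime p" "\<not> p dvd u \<or> \<not> p dvd v"
  obtains s t where "[u * s + v * t = w] (mod p)"
proof -
  have solve: "\<exists>s. [u * s = w] (mod p)" if "\<not> p dvd u" for u
    using cong_solve_dvd_int[of u p w] prime_imp_coprime[OF assms(1) that]
    by (simp add: coprime_commute)
  show ?thesis
  proof (cases "p dvd u")
    case True
    then obtain t where "[v * t = w] (mod p)" using solve assms(2) by blast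
    then show ?thesis using that[of 0 t] by simp
  next
    case False
    then obtain s where "[u * s = w] (mod p)" using solve by blast
    then show ?thesis using that[of s 0] by simp
  qed
qed

text \<open>Hensel lifting: the gradient of the form is a matrix of determinant \<open>- discr_bqf a b c\<close>
  applied to \<open>(x, y)\<close>, so it does not vanish modulo \<open>p\<close>.\<close>

lemma bqf_lift_solution:
  fixes p :: int
  assumes p: "prime p" "\<not> p dvd discr_bqf a b c" and xy: "\<not> (p dvd x \<and> p dvd y)"
    and "[bqf a b c x y = l] (mod p)"
  shows "\<exists>x' y'. [x' = x] (mod p) \<and> [y' = y] (mod p) \<and> [bqf a b c x' y' = l] (mod p ^ Suc e)"
proof (induction e)
  case 0
  show ?case using assms(4) by (intro exI[of _ x] exI[of _ y]) simp
next
  case (Suc e)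
  then obtain X Y where XY: "[X = x] (mod p)" "[Y = y] (mod p)"
    and eq: "[bqf a b c X Y = l] (mod p ^ Suc e)" by blast
  define q where "q = p ^ Suc e"
  \<comment> \<open>\<open>u\<close> and \<open>v\<close> are the partial derivatives of the form at
    \<open>(X, Y)\<close>.\<close>
  define u v where "u = 2 * a * X + b * Y" and "v = b * X + 2 * c * Y"
  obtain w where w: "bqf a b c X Y = l + q * w"
    using eq unfolding q_def by (metis cong_iff_lin cong_sym)
  have "\<not> p dvd u \<or> \<not> p dvd v"
  proof (rule ccontr)
    assume "\<not> ?thesis"
    \<comment> \<open>Each combination eliminates one coordinate, as in Cramer's rule, and leaves
      the discriminant times the other.\<close>
    then have "p dvd b * v - 2 * c * u" "p dvd b * u - 2 * a * v" by simp_all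
    moreover have "b * v - 2 * c * u = discr_bqf a b c * X" "b * u - 2 * a * v = discr_bqf a b c * Y"
      by (simp_all add: u_def v_def discr_bqf_def power2_eq_square algebra_simps)
    ultimately have "p dvd X" "p dvd Y" using p prime_dvd_mult_iff by metis+
    then show False using XY xy by (metis cong_dvd_iff)
  qed
  then obtain s t where st: "[u * s + v * t = - w] (mod p)"
    using linear_cong_solvable p(1) by blast
  \<comment> \<open>Taylor expansion: the linear term cancels the error \<open>q * w\<close> modulo
    \<open>q * p\<close>, and the quadratic term carries \<open>q * q\<close>, a multiple of
    \<open>q * p\<close>.\<close>
  have "bqf a b c (X + q * s) (Y + q * t) - l
      = q * (u * s + v * t - (- w)) + q * q * bqf a b c s t"
    using w by (simp add: bqf_def u_def v_def power2_eq_square algebra_simps)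
  moreover have "q * p dvd q * (u * s + v * t - (- w))"
    using st by (intro mult_dvd_mono) (simp_all add: cong_iff_dvd_diff)
  moreover have "q * p dvd q * q * bqf a b c s t"
    by (simp add: q_def)
  moreover have "q * p = p ^ Suc (Suc e)" by (simp add: q_def)
  ultimately have "[bqf a b c (X + q * s) (Y + q * t) = l] (mod p ^ Suc (Suc e))"
    by (metis cong_iff_dvd_diff dvd_add)
  moreover have "[X + q * s = x] (mod p)" "[Y + q * t = y] (mod p)"
    using XY by (simp_all add: q_def cong_iff_dvd_diff) 
      (metis add_diff_eq add.commute dvd_add dvd_triv_left mult.assoc add_diff_add diff_add_eq)+
  ultimately show ?case by blast
qed

section \<open>Values modulo odd primes and their powers\<close>

text \<open>Pigeonhole: for \<open>u\<close> and \<open>v\<close> from 0 to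
  \<open>(p - 1) div 2\<close>, the squares of \<open>u\<close> and the numbers
  \<open>l + d * v\<^sup>2\<close> fill \<open>(p + 1) div 2\<close> residues each, and two such
  sets among \<open>p\<close> residues meet.\<close>

lemma square_plus_square_cong:
  fixes p :: nat and d l :: int
  assumes p: "prime p" "odd p" "\<not> int p dvd d"
  obtains u v where "[u\<^sup>2 - d * v\<^sup>2 = l] (mod int p)"
proof -
  define h where "h = (int p - 1) div 2"
  have h: "int p = 2 * h + 1" using p(2) unfolding h_def by presburger
  have pr: "prime (int p)" using p(1) by simp
  have "h \<ge> 0" using h by linarith
  \<comment> \<open>The difference and the sum are at most \<open>2 * h = p - 1\<close> in absolute
    value, so the factor divisible by \<open>p\<close> is 0; the sum is 0 only for
    \<open>u = v = 0\<close>.\<close>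
  have inj_sq: "u = v" if "u \<in> {0..h}" "v \<in> {0..h}" "int p dvd u\<^sup>2 - v\<^sup>2" for u v
  proof -
    have "u\<^sup>2 - v\<^sup>2 = (u - v) * (u + v)" by (simp add: power2_eq_square algebra_simps)
    then have "int p dvd u - v \<or> int p dvd u + v"
      using that(3) pr prime_dvd_mult_iff by metis
    then show ?thesis
    proof
      assume "int p dvd u - v"
      then show ?thesis
        using that(1,2) h zdvd_not_zless[of "u - v" "int p"] zdvd_not_zless[of "v - u" "int p"]
        by (cases u v rule: linorder_cases) (auto simp: dvd_diff_commute)
    next
      assume "int p dvd u + v"
      then show ?thesis using that(1,2) h zdvd_not_zless[of "u + v" "int p"] by fastforce
    qed
  qed
  define A where "A = (\<lambda>u. u\<^sup>2 mod int p) ` {0..h}"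
  define B where "B = (\<lambda>v. (l + d * v\<^sup>2) mod int p) ` {0..h}"
  have "inj_on (\<lambda>u. u\<^sup>2 mod int p) {0..h}"
    using inj_sq by (auto intro!: inj_onI simp: mod_eq_dvd_iff)
  then have cA: "card A = nat (h + 1)" unfolding A_def by (simp add: card_image)
  have "inj_on (\<lambda>v. (l + d * v\<^sup>2) mod int p) {0..h}"
  proof (rule inj_onI)
    fix u v assume uv: "u \<in> {0..h}" "v \<in> {0..h}"
      and "(l + d * u\<^sup>2) mod int p = (l + d * v\<^sup>2) mod int p"
    then have "int p dvd d * (u\<^sup>2 - v\<^sup>2)" by (simp add: mod_eq_dvd_iff algebra_simps)
    then show "u = v" using inj_sq[OF uv] p(3) pr prime_dvd_mult_iff by blast
  qed
  then have cB: "card B = nat (h + 1)" unfolding B_def by (simp add: card_image)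
  have "A \<union> B \<subseteq> {0..<int p}" using prime_gt_0_nat[OF p(1)] by (auto simp: A_def B_def)
  then have "card (A \<union> B) \<le> p" using card_mono[of "{0..<int p}" "A \<union> B"] by simp
  moreover have "card (A \<union> B) = card A + card B" if "A \<inter> B = {}"
    using that by (intro card_Un_disjoint) (auto simp: A_def B_def)
  ultimately have "A \<inter> B \<noteq> {}" using cA cB h by fastforce
  then obtain u v where "u\<^sup>2 mod int p = (l + d * v\<^sup>2) mod int p"
    unfolding A_def B_def by auto
  then have "[u\<^sup>2 - d * v\<^sup>2 = l] (mod int p)"
    by (simp add: mod_eq_dvd_iff cong_iff_dvd_diff algebra_simps)
  then show ?thesis by (rule that)
qed

text \<open>As \<open>2 * a\<close> is a unit modulo \<open>p\<close>, \<open>x\<close> can be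
  chosen with \<open>2 * a * x + b * v\<close> congruent to \<open>u\<close>; completing the square
  and cancelling \<open>4 * a\<close> then gives the value \<open>l\<close>.\<close>

lemma bqf_solution_from_square:
  fixes p :: nat
  assumes p: "prime p" "odd p" "\<not> int p dvd a"
    and uv: "[u\<^sup>2 - discr_bqf a b c * v\<^sup>2 = 4 * a * l] (mod int p)"
  obtains x where "[bqf a b c x v = l] (mod int p)"
proof -
  have pr: "prime (int p)" using p by simp
  have "p \<noteq> 2" using p by auto
  then have "coprime p 2" using p primes_coprime two_is_prime_nat by blast
  then have "coprime (int p) 2" by (metis coprime_int_iff of_nat_numeral)
  then have cop: "coprime (2 * a) (int p)" "coprime (4 * a) (int p)"
    using prime_imp_coprime[OF pr p(3)] coprime_mult_left_iff[of 2 2 "int p"]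
    by (simp_all add: coprime_commute)
  obtain x where "[2 * a * x = u - b * v] (mod int p)"
    using cong_solve_dvd_int[of "2 * a" "int p" "u - b * v"] cop by auto
  then have "[2 * a * x + b * v = u - b * v + b * v] (mod int p)"
    by (intro cong_add cong_refl)
  then have "[(2 * a * x + b * v)\<^sup>2 = u\<^sup>2] (mod int p)"
    by (intro cong_pow) simp
  then have "[(2 * a * x + b * v)\<^sup>2 - discr_bqf a b c * v\<^sup>2 = u\<^sup>2 - discr_bqf a b c * v\<^sup>2] (mod int p)"
    by (intro cong_diff cong_refl)
  then have "[4 * a * bqf a b c x v = 4 * a * l] (mod int p)"
    unfolding complete_square using uv cong_trans by blast
  then have "[bqf a b c x v = l] (mod int p)"
    using cop(2) cong_mult_lcancel by blast
  then show ?thesis by (rule that)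
qed

lemma bqf_surj_mod_prime:
  assumes p: "prime p" "odd p" "\<not> int p dvd discr_bqf a b c"
  shows "\<exists>x y. [bqf a b c x y = l] (mod int p)"
proof -
  have main: "\<exists>x y. [bqf a b c x y = l] (mod int p)"
    if "\<not> int p dvd a" "\<not> int p dvd discr_bqf a b c" for a c
    using square_plus_square_cong[OF p(1,2) that(2)] bqf_solution_from_square[OF p(1,2) that(1)]
    by metis
  consider "\<not> int p dvd a" | "\<not> int p dvd c" | "int p dvd a" "int p dvd c" by blast
  then show ?thesis
  proof cases
    case 1
    then show ?thesis using main p by blast
  next
    case 2
    then show ?thesis using main[of c a] p bqf_commute discr_bqf_commute by metis
  next
    \<comment> \<open>Now the form is \<open>b * x * y\<close> modulo \<open>p\<close> with
      \<open>b\<close> a unit, and \<open>y = 1\<close> leaves a linear congruence.\<close>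
    case 3
    then have "\<not> int p dvd b" using p(3) by (auto simp: discr_bqf_def power2_eq_square)
    then obtain x where x: "[b * x = l] (mod int p)"
      using linear_cong_solvable[of "int p" b 0 l] p(1) by auto
    have "[a * x\<^sup>2 + b * x + c = 0 + l + 0] (mod int p)"
      using 3 x by (intro cong_add) (simp_all add: cong_0_iff)
    then show ?thesis by (intro exI[of _ x] exI[of _ 1]) (simp add: bqf_def)
  qed
qed

text \<open>Lifting must start away from the origin modulo \<open>p\<close>. If \<open>p\<close>
  does not divide \<open>l\<close>, every solution qualifies; otherwise the isotropic vector is the
  start. The case \<open>p = 2\<close> is used too.\<close>

lemma no_obstruction_prime_power:
  fixes p :: nat
  assumes p: "prime p" "\<not> int p dvd discr_bqf a b c"
    and surj: "\<And>l. \<exists>x y. [bqf a b c x y = l] (mod int p)"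
    and isotropic: "\<exists>x y. \<not> (int p dvd x \<and> int p dvd y) \<and> int p dvd bqf a b c x y"
  shows "\<not> has_local_obstruction (bqf a b c) (p ^ e)"
proof (cases e)
  case 0
  then show ?thesis by (simp add: has_local_obstruction_def)
next
  case (Suc e')
  have pr: "prime (int p)" using p by simp
  have "\<exists>x y. [bqf a b c x y = l] (mod int p ^ Suc e')" for l
  proof -
    have "\<exists>x y. \<not> (int p dvd x \<and> int p dvd y) \<and> [bqf a b c x y = l] (mod int p)"
    proof (cases "int p dvd l")
      case True
      then show ?thesis using isotropic by (meson cong_0_iff cong_sym cong_trans)
    next
      case False
      then obtain x y where xy: "[bqf a b c x y = l] (mod int p)" using surj by blast
      have "\<not> (int p dvd x \<and> int p dvd y)"
      proof
        assume "int p dvd x \<and> int p dvd y"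
        then have "int p dvd bqf a b c x y" by (simp add: bqf_def power2_eq_square)
        then show False using xy False cong_dvd_iff by blast
      qed
      then show ?thesis using xy by blast
    qed
    then show ?thesis using bqf_lift_solution[OF pr p(2)] by blast
  qed
  then show ?thesis unfolding has_local_obstruction_def Suc by simp
qed

text \<open>If \<open>p\<close> divides \<open>a\<close>, the vector \<open>(1, 0)\<close> is
  isotropic; otherwise a square root of the discriminant yields a zero with
  \<open>y = 1\<close>.\<close>

lemma bqf_isotropic_mod_prime:
  fixes p :: nat
  assumes p: "prime p" "odd p" "Legendre (discr_bqf a b c) (int p) = 1"
  shows "\<exists>x y. \<not> (int p dvd x \<and> int p dvd y) \<and> int p dvd bqf a b c x y"
proof (cases "int p dvd a")
  case True
  then show ?thesis
    using p(1) by (intro exI[of _ 1] exI[of _ 0]) (auto simp: bqf_def prime_nat_iff)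
next
  case False
  obtain u where "[u\<^sup>2 = discr_bqf a b c] (mod int p)"
    using p(3) by (auto simp: Legendre_def QuadRes_def split: if_splits)
  then have "[u\<^sup>2 - discr_bqf a b c * 1\<^sup>2 = 4 * a * 0] (mod int p)"
    by (simp add: cong_iff_dvd_diff)
  then obtain x where "[bqf a b c x 1 = 0] (mod int p)"
    using bqf_solution_from_square[OF p(1,2) False] by blast
  then show ?thesis
    using p(1) by (intro exI[of _ x] exI[of _ 1]) (auto simp: cong_0_iff prime_nat_iff)
qed

section \<open>Obstructed moduli at odd primes\<close>

text \<open>1 and \<open>p - 1\<close> have the same square, so squaring is not injective on the
  \<open>p\<close> residues and cannot be onto.\<close>

lemma ex_nonsquare_mod:
  fixes p :: nat
  assumes "p > 2"
  obtains r :: int where "\<And>u. \<not> [u\<^sup>2 = r] (mod int p)"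
proof -
  define f where "f = (\<lambda>u::int. u\<^sup>2 mod int p)"
  have "f (int p - 1) = f 1"
    by (simp add: f_def mod_eq_dvd_iff power2_eq_square algebra_simps)
  moreover have "{0..<int p} = insert (int p - 1) {0..<int p - 1}" using assms by auto
  moreover have "f 1 \<in> f ` {0..<int p - 1}" using assms by simp
  ultimately have "f ` {0..<int p} = f ` {0..<int p - 1}" by (simp add: insert_absorb)
  then have "card (f ` {0..<int p}) \<le> p - 1"
    using card_image_le[of "{0..<int p - 1}" f] by (simp add: nat_diff_distrib)
  moreover have "card {0..<int p} = p" by simp
  ultimately have "\<not> {0..<int p} \<subseteq> f ` {0..<int p}"
    using assms card_mono[of "f ` {0..<int p}" "{0..<int p}"] by auto
  then obtain r where r: "r \<in> {0..<int p}" "r \<notin> f ` {0..<int p}" by blast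
  have "\<not> [u\<^sup>2 = r] (mod int p)" for u
  proof
    assume "[u\<^sup>2 = r] (mod int p)"
    then have "r = f (u mod int p)" using r(1) by (simp add: f_def cong_def power_mod)
    moreover have "u mod int p \<in> {0..<int p}" using assms by simp
    ultimately show False using r(2) by blast
  qed
  then show ?thesis by (rule that)
qed

text \<open>If \<open>p\<close> does not divide \<open>a\<close>, completing the square makes
  \<open>4 * a\<close> times every value a square modulo \<open>p\<close>, so any \<open>l\<close>
  with \<open>4 * a * l\<close> a nonsquare is missed.\<close>

lemma obstruction_dvd_discr:
  fixes p :: nat
  assumes p: "prime p" "odd p" "int p dvd discr_bqf a b c"
    and prim: "primitive_bqf a b c"
  shows "has_local_obstruction (bqf a b c) p"
proof -
  have pr: "prime (int p)" using p by simp
  have "p > 2" using odd_prime_gt_2 p by blast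
  then obtain r where r: "\<And>u. \<not> [u\<^sup>2 = r] (mod int p)" using ex_nonsquare_mod by blast
  have main: "has_local_obstruction (bqf a b c) p"
    if discr: "int p dvd discr_bqf a b c" and a: "\<not> int p dvd a" for a c
  proof -
    have "\<not> int p dvd 4"
    proof
      assume "int p dvd 4"
      then have "int p dvd 2 ^ 2" by simp
      then have "int p dvd 2" using pr prime_dvd_power by blast
      then show False using \<open>p > 2\<close> zdvd_imp_le by fastforce
    qed
    then have "\<not> int p dvd 4 * a" using a pr prime_dvd_mult_iff by blast
    then obtain l where l: "[4 * a * l = r] (mod int p)"
      using linear_cong_solvable[of "int p" "4 * a" 0 r] pr by auto
    have "\<not> [bqf a b c x y = l] (mod int p)" for x y
    proof
      assume "[bqf a b c x y = l] (mod int p)"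
      then have "[4 * a * bqf a b c x y = 4 * a * l] (mod int p)" by (intro cong_mult cong_refl)
      then have "[4 * a * bqf a b c x y = r] (mod int p)" using l cong_trans by blast
      moreover have "[discr_bqf a b c * y\<^sup>2 = 0] (mod int p)" using discr by (simp add: cong_0_iff)
      ultimately have "[4 * a * bqf a b c x y + discr_bqf a b c * y\<^sup>2 = r + 0] (mod int p)"
        by (intro cong_add)
      then show False using r[of "2 * a * x + b * y"] unfolding complete_square by simp
    qed
    then show ?thesis unfolding has_local_obstruction_def by blast
  qed
  \<comment> \<open>Otherwise \<open>p\<close> would divide \<open>b\<^sup>2\<close>, hence all
    three coefficients, against primitivity.\<close>
  have "\<not> int p dvd a \<or> \<not> int p dvd c"
  proof (rule ccontr)
    assume *: "\<not> ?thesis"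
    then have "int p dvd discr_bqf a b c + 4 * a * c" using p(3) by simp
    then have "int p dvd b\<^sup>2" by (simp add: discr_bqf_def)
    then have "int p dvd b" using pr prime_dvd_power by blast
    then have "int p dvd Gcd {a, b, c}" using * by (intro Gcd_greatest) auto
    then have "int p dvd 1" using prim by (simp only: primitive_bqf_def)
    then show False using pr by (simp only: not_prime_unit)
  qed
  then show ?thesis
    using main[of a c] main[of c a] p(3) has_local_obstruction_bqf_commute discr_bqf_commute
    by metis
qed

text \<open>The form is anisotropic modulo \<open>q\<close>: a value divisible by \<open>q\<close>
  forces \<open>q\<close> to divide \<open>x\<close> and \<open>y\<close>, so that value is
  divisible by \<open>q\<^sup>2\<close>. Hence \<open>q\<close> itself is missed.\<close>

lemma obstruction_nonresidue:
  fixes q :: nat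
  assumes q: "prime q" "odd q" "Legendre (discr_bqf a b c) (int q) = -1"
  shows "has_local_obstruction (bqf a b c) (q\<^sup>2)"
proof -
  have pr: "prime (int q)" using q by simp
  have nonres: "\<not> [u\<^sup>2 = discr_bqf a b c] (mod int q)" for u
    using q(3) by (auto simp: Legendre_def QuadRes_def split: if_splits)
  have a: "\<not> int q dvd a"
  proof
    assume "int q dvd a"
    then have "[b\<^sup>2 = discr_bqf a b c] (mod int q)" by (simp add: discr_bqf_def cong_iff_dvd_diff)
    with nonres show False by blast
  qed
  have two: "\<not> int q dvd 2"
    using q prime_gt_1_nat[of q] by (auto dest!: zdvd_imp_le simp: le_Suc_eq numeral_2_eq_2)
  have "\<not> [bqf a b c x y = int q] (mod int (q\<^sup>2))" for x y
  proof
    assume eq: "[bqf a b c x y = int q] (mod int (q\<^sup>2))"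
    then have "[bqf a b c x y = int q] (mod int q)"
      by (rule cong_dvd_modulus) (simp add: power2_eq_square)
    then have dvd: "int q dvd bqf a b c x y" using cong_dvd_iff dvd_refl by blast
    then have "int q dvd 4 * a * bqf a b c x y" by simp
    then have sq: "[(2 * a * x + b * y)\<^sup>2 = discr_bqf a b c * y\<^sup>2] (mod int q)"
      by (simp add: complete_square cong_iff_dvd_diff)
    \<comment> \<open>An inverse \<open>z\<close> of \<open>y\<close> would make the discriminant
      congruent to the square of \<open>(2 * a * x + b * y) * z\<close>.\<close>
    have y: "int q dvd y"
    proof (rule ccontr)
      assume "\<not> int q dvd y"
      then obtain z where z: "[y * z = 1] (mod int q)"
        using linear_cong_solvable[of "int q" y 0 1] pr by auto
      have "[(2 * a * x + b * y)\<^sup>2 * z\<^sup>2 = discr_bqf a b c * y\<^sup>2 * z\<^sup>2] (mod int q)"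
        using sq by (intro cong_mult cong_refl)
      moreover have "[discr_bqf a b c * (y * z)\<^sup>2 = discr_bqf a b c * 1\<^sup>2] (mod int q)"
        using z by (intro cong_mult cong_pow cong_refl)
      ultimately have "[((2 * a * x + b * y) * z)\<^sup>2 = discr_bqf a b c] (mod int q)"
        using cong_trans by (fastforce simp: power_mult_distrib mult.assoc)
      with nonres show False by blast
    qed
    then have "int q dvd a * x\<^sup>2"
      using dvd by (simp add: bqf_def power2_eq_square dvd_add_left_iff)
    then have x: "int q dvd x" using a pr prime_dvd_mult_iff prime_dvd_power by blast
    have "int (q\<^sup>2) dvd bqf a b c x y"
      using x y by (auto simp: bqf_def power2_eq_square intro!: dvd_add elim!: dvdE)
    then have "int (q\<^sup>2) dvd int q" using eq cong_dvd_iff by blast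
    then have "q\<^sup>2 dvd q" by (simp only: int_dvd_int_iff)
    then show False using prime_gt_1_nat[OF q(1)] by (auto simp: power2_eq_square dest: dvd_imp_le)
  qed
  then show ?thesis unfolding has_local_obstruction_def by blast
qed

section \<open>Obstructions at the prime 2\<close>

text \<open>Some coefficient is odd, so one of \<open>(1, 0)\<close>, \<open>(0, 1)\<close>,
  \<open>(1, 1)\<close> gives an odd value, while the origin gives an even one.\<close>

lemma no_obstruction_2:
  assumes "primitive_bqf a b c"
  shows "\<not> has_local_obstruction (bqf a b c) 2"
proof -
  have "\<not> (even a \<and> even b \<and> even c)"
  proof
    assume "even a \<and> even b \<and> even c"
    then have "2 dvd Gcd {a, b, c}" by (intro Gcd_greatest) auto
    then show False using assms by (simp only: primitive_bqf_def) simp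
  qed
  then have "odd (bqf a b c 1 0) \<or> odd (bqf a b c 0 1) \<or> odd (bqf a b c 1 1)"
    by (auto simp: bqf_def)
  moreover have "even (bqf a b c 0 0)" by (simp add: bqf_def)
  ultimately have "\<exists>x y. even (bqf a b c x y) = even l" for l by metis
  then show ?thesis
    unfolding has_local_obstruction_def by (auto simp: cong_iff_dvd_diff)
qed

text \<open>With \<open>b = 2 * j + 1\<close>, the evenness of \<open>j * (j + 1)\<close> makes
  \<open>a * c\<close> even. Then \<open>(1, 0)\<close> or \<open>(0, 1)\<close> is a zero modulo 2,
  and lifting works because the discriminant is odd.\<close>

lemma no_obstruction_power_of_2:
  assumes "primitive_bqf a b c" "[discr_bqf a b c = 1] (mod 8)"
  shows "\<not> has_local_obstruction (bqf a b c) (2 ^ e)"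
proof (rule no_obstruction_prime_power)
  have "(8::int) dvd discr_bqf a b c - 1" using assms(2) by (simp add: cong_iff_dvd_diff)
  then obtain k where k: "discr_bqf a b c - 1 = 8 * k" by blast
  then have b: "b\<^sup>2 - 4 * (a * c) = 8 * k + 1" by (simp add: discr_bqf_def)
  then have "b\<^sup>2 = 2 * (4 * k + 2 * (a * c)) + 1" by simp
  then have "odd (b\<^sup>2)" by simp
  then have "odd b" by simp
  then obtain j where "b = 2 * j + 1" by (elim oddE)
  then have "a * c = j * (j + 1) - 2 * k"
    using b by (simp add: power2_eq_square algebra_simps)
  then have "even (a * c)" by simp
  then show "\<exists>x y. \<not> (int 2 dvd x \<and> int 2 dvd y) \<and> int 2 dvd bqf a b c x y"
  proof (cases "even a")
    case True
    then show ?thesis by (intro exI[of _ 1] exI[of _ 0]) (simp add: bqf_def)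
  next
    case False
    then have "even c" using \<open>even (a * c)\<close> by simp
    then show ?thesis by (intro exI[of _ 0] exI[of _ 1]) (simp add: bqf_def)
  qed
  show "\<not> int 2 dvd discr_bqf a b c" using k by simp presburger
  show "\<exists>x y. [bqf a b c x y = l] (mod int 2)" for l
    using no_obstruction_2[OF assms(1)] unfolding has_local_obstruction_def by blast
qed simp

text \<open>Here \<open>a * c\<close> is odd, so all coefficients are odd and a value is even only
  for even \<open>x\<close> and \<open>y\<close>. It is then divisible by 4, so 2 is missed.\<close>

lemma obstruction_4_odd_discr:
  assumes "[discr_bqf a b c = 5] (mod 8)"
  shows "has_local_obstruction (bqf a b c) 4"
proof -
  have "(8::int) dvd discr_bqf a b c - 5" using assms by (simp add: cong_iff_dvd_diff)
  then obtain k where k: "discr_bqf a b c - 5 = 8 * k" by blast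
  then have b: "b\<^sup>2 - 4 * (a * c) = 8 * k + 5" by (simp add: discr_bqf_def)
  then have "b\<^sup>2 = 2 * (4 * k + 2 + 2 * (a * c)) + 1" by simp
  then have "odd (b\<^sup>2)" by simp
  then have "odd b" by simp
  then obtain j where "b = 2 * j + 1" by (elim oddE)
  then have "a * c = j * (j + 1) - 2 * k - 1"
    using b by (simp add: power2_eq_square algebra_simps)
  then have "odd (a * c)" by simp
  then have abc: "odd a" "odd b" "odd c" using \<open>odd b\<close> by auto
  have "\<not> [bqf a b c x y = 2] (mod int 4)" for x y
  proof
    assume "[bqf a b c x y = 2] (mod int 4)"
    then have eq: "4 dvd bqf a b c x y - 2" by (simp add: cong_iff_dvd_diff)
    then have "even (bqf a b c x y)" by presburger
    then have "even x" "even y" using abc by (auto simp: bqf_def)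
    then have "4 dvd bqf a b c x y"
      by (auto simp: bqf_def power2_eq_square elim!: evenE intro!: dvd_add)
    with eq show False by presburger
  qed
  then show ?thesis unfolding has_local_obstruction_def by auto
qed

section \<open>Discriminants divisible by 4, modulo 4 and 8\<close>

text \<open>An even middle coefficient allows the factor \<open>a\<close> in place of
  \<open>4 * a\<close>; for odd \<open>a\<close> it is a unit modulo powers of 2.\<close>

lemma complete_square_even:
  "a * bqf a (2 * b) c x y = (a * x + b * y)\<^sup>2 - (b\<^sup>2 - a * c) * y\<^sup>2"
  by (simp add: bqf_def power2_eq_square algebra_simps)

lemma odd_square_mod_8:
  assumes "odd (a::int)"
  shows "[a * a = 1] (mod 8)"
proof -
  obtain j where "a = 2 * j + 1" using assms by (elim oddE)
  then have "a * a - 1 = 4 * (j * (j + 1))" by (simp add: algebra_simps)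
  moreover have "even (j * (j + 1))" by simp
  then obtain i where "j * (j + 1) = 2 * i" by blast
  ultimately have "a * a - 1 = 8 * i" by simp
  then show ?thesis by (simp add: cong_iff_dvd_diff)
qed

text \<open>An odd \<open>a\<close> is its own inverse modulo divisors of 8, so a residue
  \<open>r\<close> missed by the norm form makes the form miss \<open>a * r\<close>.\<close>

lemma obstruction_from_square:
  assumes "odd a" "int k dvd 8" and "\<And>u v. \<not> [u\<^sup>2 - (b\<^sup>2 - a * c) * v\<^sup>2 = r] (mod int k)"
  shows "has_local_obstruction (bqf a (2 * b) c) k"
proof -
  have "\<not> [bqf a (2 * b) c x y = a * r] (mod int k)" for x y
  proof
    assume "[bqf a (2 * b) c x y = a * r] (mod int k)"
    then have "[a * bqf a (2 * b) c x y = a * (a * r)] (mod int k)" by (intro cong_mult cong_refl)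
    moreover have "[a * a * r = 1 * r] (mod int k)"
      using cong_dvd_modulus[OF odd_square_mod_8[OF assms(1)] assms(2)] by (intro cong_mult cong_refl)
    ultimately have "[a * bqf a (2 * b) c x y = r] (mod int k)"
      using cong_trans by (simp add: mult.assoc) blast
    then show False using assms(3) unfolding complete_square_even by blast
  qed
  then show ?thesis unfolding has_local_obstruction_def by blast
qed

lemma square_mod_8: "(u::int)\<^sup>2 mod 8 \<in> {0, 1, 4}"
proof (cases "even u")
  case True
  then obtain j where "u = 2 * j" by blast
  then have "u\<^sup>2 = 4 * (j * j)" by (simp add: power2_eq_square)
  then show ?thesis by simp presburger
next
  case False
  then show ?thesis using odd_square_mod_8 by (simp add: cong_def power2_eq_square)
qed

lemma square_mod_4: "(u::int)\<^sup>2 mod 4 \<in> {0, 1}"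
proof (cases "even u")
  case False
  then have "[u * u = 1] (mod 4)"
    using cong_dvd_modulus[OF odd_square_mod_8, of u 4] by simp
  then show ?thesis by (simp add: cong_def power2_eq_square)
qed (auto simp: power2_eq_square)

lemma norm_form_mod:
  fixes D :: int
  shows "(u\<^sup>2 - D * v\<^sup>2) mod k = ((u\<^sup>2 mod k) - (D mod k) * (v\<^sup>2 mod k)) mod k"
  by (intro mod_diff_cong mod_mult_cong) simp_all

lemma norm_form_obstruction_4:
  fixes D :: int
  assumes "D mod 4 \<noteq> 2"
  shows "\<exists>r. \<forall>u v. \<not> [u\<^sup>2 - D * v\<^sup>2 = r] (mod int 4)"
proof -
  have "D mod 4 \<in> {0, 1, 3}" using assms by simp presburger
  \<comment> \<open>Modulo 4 the values are among 0, 1, 3 for \<open>D mod 4 = 1\<close>, among 0, 1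
    for residue 0, and among 0, 1, 2 for residue 3.\<close>
  moreover have "\<not> [u\<^sup>2 - D * v\<^sup>2 = (if D mod 4 = 1 then 2 else 3)] (mod 4)"
    if "D mod 4 \<in> {0, 1, 3}" for u v
    using that square_mod_4[of u] square_mod_4[of v] unfolding cong_def norm_form_mod[of u D v 4]
    by auto
  ultimately show ?thesis by auto
qed

lemma norm_form_obstruction_8:
  fixes D :: int
  assumes "D mod 4 = 2"
  shows "\<exists>r. \<forall>u v. \<not> [u\<^sup>2 - D * v\<^sup>2 = r] (mod int 8)"
proof -
  obtain k where k: "D = 4 * k + 2" using assms by (metis mult_div_mod_eq)
  have "D mod 8 \<in> {2, 6}"
  proof (cases "even k")
    case True
    then obtain j where "k = 2 * j" by blast
    then have "D = 2 + 8 * j" using k by simp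
    then show ?thesis by simp
  next
    case False
    then obtain j where "k = 2 * j + 1" by (elim oddE)
    then have "D = 6 + 8 * j" using k by simp
    then show ?thesis by simp
  qed
  \<comment> \<open>Modulo 8 the values are among 0, 1, 2, 4, 6, 7 for \<open>D mod 8 = 2\<close>
    and among 0, 1, 2, 3, 4, 6 for residue 6.\<close>
  moreover have "\<not> [u\<^sup>2 - D * v\<^sup>2 = (if D mod 8 = 2 then 3 else 5)] (mod 8)"
    if "D mod 8 \<in> {2, 6}" for u v
    using that square_mod_8[of u] square_mod_8[of v] unfolding cong_def norm_form_mod[of u D v 8]
    by auto
  ultimately show ?thesis by auto
qed

text \<open>Modulo 4 this is \<open>u\<^sup>2 + 2 * v\<^sup>2\<close>, with values 0, 1, 2, 3 at
  \<open>(0, 0)\<close>, \<open>(1, 0)\<close>, \<open>(0, 1)\<close>,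
  \<open>(1, 1)\<close>.\<close>

lemma norm_form_surj_4:
  fixes D :: int
  assumes "D mod 4 = 2"
  shows "\<exists>u v. [u\<^sup>2 - D * v\<^sup>2 = r] (mod 4)"
proof -
  have D: "(- D) mod 4 = 2" "(1 - D) mod 4 = 3"
    using assms by (simp_all add: zmod_zminus1_eq_if mod_diff_right_eq[of 1 D, symmetric])
  consider "r mod 4 = 0" | "r mod 4 = 1" | "r mod 4 = 2" | "r mod 4 = 3" by fastforce
  then show ?thesis
  proof cases
    case 1
    then show ?thesis by (intro exI[of _ 0]) (simp add: cong_def)
  next
    case 2
    then show ?thesis by (intro exI[of _ 1] exI[of _ 0]) (simp add: cong_def)
  next
    case 3
    then show ?thesis using D by (intro exI[of _ 0] exI[of _ 1]) (simp add: cong_def)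
  next
    case 4
    then show ?thesis using D by (intro exI[of _ 1]) (simp add: cong_def)
  qed
qed

text \<open>With \<open>b\<close> even, primitivity leaves an odd outer coefficient, the unit needed
  to complete the square modulo powers of 2.\<close>

lemma even_discr_cases:
  assumes "primitive_bqf a b c" "4 dvd discr_bqf a b c"
  obtains b' where "b = 2 * b'" "discr_bqf a b c = 4 * (b'\<^sup>2 - a * c)" "odd a \<or> odd c"
proof -
  have "even (discr_bqf a b c + 4 * a * c)" using assms(2) by auto
  then have "even b" by (simp add: discr_bqf_def)
  then obtain b' where b': "b = 2 * b'" by blast
  have "odd a \<or> odd c"
  proof (rule ccontr)
    assume "\<not> ?thesis"
    then have "2 dvd Gcd {a, b, c}" using \<open>even b\<close> by (intro Gcd_greatest) auto
    then show False using assms by (simp only: primitive_bqf_def) simp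
  qed
  moreover have "discr_bqf a b c = 4 * (b'\<^sup>2 - a * c)"
    by (simp add: b' discr_bqf_def power2_eq_square)
  ultimately show ?thesis using that b' by blast
qed

lemma obstruction_even_discr:
  assumes "primitive_bqf a b c" "4 dvd discr_bqf a b c" "int k dvd 8"
    and "\<exists>r. \<forall>u v. \<not> [u\<^sup>2 - discr_bqf a b c div 4 * v\<^sup>2 = r] (mod int k)"
  shows "has_local_obstruction (bqf a b c) k"
proof -
  obtain b' where b: "b = 2 * b'" and D: "discr_bqf a b c = 4 * (b'\<^sup>2 - a * c)" and "odd a \<or> odd c"
    using even_discr_cases assms(1,2) by blast
  obtain r where r: "\<And>u v. \<not> [u\<^sup>2 - (b'\<^sup>2 - a * c) * v\<^sup>2 = r] (mod int k)"
    using assms(4) D by auto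
  \<comment> \<open>The norm form is symmetric in \<open>a\<close> and \<open>c\<close>, so the same
    residue serves when \<open>c\<close> is the odd coefficient.\<close>
  have r': "\<And>u v. \<not> [u\<^sup>2 - (b'\<^sup>2 - c * a) * v\<^sup>2 = r] (mod int k)"
    using r by (simp add: mult.commute)
  show ?thesis
    using \<open>odd a \<or> odd c\<close> obstruction_from_square[OF _ assms(3) r]
      obstruction_from_square[OF _ assms(3) r'] has_local_obstruction_bqf_commute b by blast
qed

lemma no_obstruction_4:
  assumes "primitive_bqf a b c" "4 dvd discr_bqf a b c" "discr_bqf a b c div 4 mod 4 = 2"
  shows "\<not> has_local_obstruction (bqf a b c) 4"
proof -
  obtain b' where b: "b = 2 * b'" and D: "discr_bqf a b c = 4 * (b'\<^sup>2 - a * c)" and "odd a \<or> odd c"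
    using even_discr_cases assms(1,2) by blast
  have main: "\<not> has_local_obstruction (bqf a (2 * b') c) 4"
    if a: "odd a" and D: "(b'\<^sup>2 - a * c) mod 4 = 2" for a c
  proof -
    have "\<exists>x y. [bqf a (2 * b') c x y = l] (mod 4)" for l
    proof -
      obtain u v where uv: "[u\<^sup>2 - (b'\<^sup>2 - a * c) * v\<^sup>2 = a * l] (mod 4)"
        using norm_form_surj_4[OF D] by blast
      have aa: "[a * a = 1] (mod 4)"
        using cong_dvd_modulus[OF odd_square_mod_8[OF a], of 4] by simp
      \<comment> \<open>As \<open>a\<close> is its own inverse modulo 4, this \<open>x\<close>
        solves \<open>a * x + b' * v = u\<close> modulo 4.\<close>
      define x where "x = a * (u - b' * v)"
      have "[a * a * (u - b' * v) + b' * v = 1 * (u - b' * v) + b' * v] (mod 4)"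
        using aa by (intro cong_add cong_mult cong_refl)
      then have "[(a * x + b' * v)\<^sup>2 = u\<^sup>2] (mod 4)"
        by (intro cong_pow) (simp add: x_def mult.assoc)
      then have "[(a * x + b' * v)\<^sup>2 - (b'\<^sup>2 - a * c) * v\<^sup>2 = u\<^sup>2 - (b'\<^sup>2 - a * c) * v\<^sup>2] (mod 4)"
        by (intro cong_diff cong_refl)
      then have "[a * bqf a (2 * b') c x v = a * l] (mod 4)"
        unfolding complete_square_even using uv cong_trans by blast
      moreover have "coprime a 4"
        using a coprime_mult_right_iff[of a 2 2] by simp
      ultimately have "[bqf a (2 * b') c x v = l] (mod 4)" using cong_mult_lcancel by blast
      then show ?thesis by blast
    qed
    then show ?thesis unfolding has_local_obstruction_def by auto
  qed
  have "(b'\<^sup>2 - a * c) mod 4 = 2" "(b'\<^sup>2 - c * a) mod 4 = 2"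
    using assms(3) D by (simp_all add: mult.commute)
  then show ?thesis
    using \<open>odd a \<or> odd c\<close> main has_local_obstruction_bqf_commute b by blast
qed

section \<open>The minimal obstruction modulus\<close>

lemma no_obstruction_prime:
  assumes "prime p" "odd p" "\<not> int p dvd discr_bqf a b c"
  shows "\<not> has_local_obstruction (bqf a b c) p"
  using bqf_surj_mod_prime[OF assms] unfolding has_local_obstruction_def by blast

text \<open>Since 9 exceeds 8, the odd prime powers below \<open>K\<close> are primes, and these are
  unobstructed unless they divide the discriminant.\<close>

lemma min_obstruction_modulus_eqI_le_8:
  assumes "has_local_obstruction (bqf a b c) K" "K > 0" "K \<le> 8"
    and two: "\<And>e. e > 0 \<Longrightarrow> 2 ^ e < K \<Longrightarrow> \<not> has_local_obstruction (bqf a b c) (2 ^ e)"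
    and odd_prime: "\<And>p. prime p \<Longrightarrow> odd p \<Longrightarrow> p < K \<Longrightarrow> \<not> int p dvd discr_bqf a b c"
  shows "min_obstruction_modulus (bqf a b c) = enat K"
proof (rule min_obstruction_modulus_eqI[OF assms(1,2)])
  fix p e :: nat
  assume p: "prime p" "e > 0" "p ^ e < K"
  show "\<not> has_local_obstruction (bqf a b c) (p ^ e)"
  proof (cases "odd p")
    case False
    then have "p = 2" using p(1) prime_odd_nat prime_ge_2_nat[of p] by fastforce
    then show ?thesis using two p by simp
  next
    case True
    then have "p \<ge> 3" using odd_prime_gt_2[OF p(1)] by simp
    have "e = 1"
    proof (rule ccontr)
      assume "e \<noteq> 1"
      then have "3 ^ 2 \<le> p ^ 2" "p ^ 2 \<le> p ^ e"
        using \<open>p \<ge> 3\<close> p(2) by (intro power_mono power_increasing; simp)+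
      then show False using p(3) assms(3) by simp
    qed
    then show ?thesis using no_obstruction_prime p odd_prime True by simp
  qed
qed

text \<open>The witness \<open>p\<close> rules out the unspecified case of
  \<open>LEAST\<close>.\<close>

lemma p_min:
  assumes "prime p" "odd p" "int p dvd D"
  shows "prime (p_min D)" "odd (p_min D)" "int (p_min D) dvd D" "p_min D \<le> p"
proof -
  let ?P = "\<lambda>p. prime p \<and> odd p \<and> int p dvd D"
  have "?P (p_min D)" unfolding p_min_def using assms by (intro LeastI[of ?P p]) simp
  then show "prime (p_min D)" "odd (p_min D)" "int (p_min D) dvd D" by simp_all
  show "p_min D \<le> p" unfolding p_min_def using assms by (intro Least_le) simp
qed

lemma q_min:
  assumes "prime q" "odd q" "Legendre D (int q) = -1"
  shows "prime (q_min D)" "odd (q_min D)" "Legendre D (int (q_min D)) = -1" "q_min D \<le> q"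
proof -
  let ?P = "\<lambda>q. prime q \<and> odd q \<and> Legendre D (int q) = -1"
  have "?P (q_min D)" unfolding q_min_def using assms by (intro LeastI[of ?P q]) simp
  then show "prime (q_min D)" "odd (q_min D)" "Legendre D (int (q_min D)) = -1" by simp_all
  show "q_min D \<le> q" unfolding q_min_def using assms by (intro Least_le) simp
qed

text \<open>Powers of 2 are never obstructed. An odd prime \<open>r\<close> below the bound does not
  divide the discriminant. If the discriminant is a residue modulo \<open>r\<close>, no power of
  \<open>r\<close> is obstructed; if not, \<open>r\<close> is at least \<open>q_min\<close>, so only
  \<open>r\<close> itself, which is unobstructed, can lie below the bound.\<close>

lemma min_obstruction_modulus_discr_1_mod_8:
  assumes prim: "primitive_bqf a b c" and neg: "discr_bqf a b c < 0"
    and mod8: "[discr_bqf a b c = 1] (mod 8)"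
  shows "min_obstruction_modulus (bqf a b c)
    = enat (min (p_min (discr_bqf a b c)) ((q_min (discr_bqf a b c))\<^sup>2))"
proof -
  define D where "D = discr_bqf a b c"
  have "8 dvd D - 1" using mod8 by (simp add: D_def cong_iff_dvd_diff)
  \<comment> \<open>Excluding -1 gives \<open>D\<close> a prime divisor, so that
    \<open>p_min D\<close> is specified.\<close>
  then have "odd D" "[D = 1] (mod 4)" "D \<noteq> -1" unfolding cong_iff_dvd_diff by presburger+
  then have "nat \<bar>D\<bar> \<noteq> 1" using neg by (simp add: D_def)
  then obtain p where p: "prime p" "p dvd nat \<bar>D\<bar>" using prime_factor_nat by blast
  then have "int p dvd D" by (simp add: int_dvd_int_iff[symmetric])
  then have "odd p" using \<open>odd D\<close> by (metis dvd_trans even_of_nat_iff)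
  note P = p_min[OF p(1) \<open>odd p\<close> \<open>int p dvd D\<close>]
  obtain q where "prime q" "odd q" "Legendre D (int q) = -1"
    using ex_prime_Legendre_minus_one \<open>[D = 1] (mod 4)\<close> neg D_def by blast
  note Q = q_min[OF this]
  have "has_local_obstruction (bqf a b c) (p_min D)"
    using obstruction_dvd_discr P(1-3) prim by (simp add: D_def)
  moreover have "has_local_obstruction (bqf a b c) ((q_min D)\<^sup>2)"
    using obstruction_nonresidue Q(1-3) by (simp add: D_def)
  ultimately have "has_local_obstruction (bqf a b c) (min (p_min D) ((q_min D)\<^sup>2))"
    by (simp add: min_def)
  moreover have "min (p_min D) ((q_min D)\<^sup>2) > 0" using P(1) Q(1) prime_gt_0_nat by simp
  moreover have "\<not> has_local_obstruction (bqf a b c) (r ^ e)"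
    if r: "prime r" "e > 0" "r ^ e < min (p_min D) ((q_min D)\<^sup>2)" for r e
  proof (cases "odd r")
    case False
    then have "r = 2" using r(1) prime_odd_nat prime_ge_2_nat[of r] by fastforce
    then show ?thesis using no_obstruction_power_of_2[OF prim mod8] by simp
  next
    case True
    have "r \<le> r ^ e" using r(2) prime_gt_0_nat[OF r(1)] by (intro self_le_power) auto
    then have "r < p_min D" using r(3) by simp
    then have ndvd: "\<not> int r dvd D" using p_min(4)[OF r(1) True, of D] by auto
    show ?thesis
    proof (cases "Legendre D (int r) = -1")
      case False
      then have "Legendre D (int r) = 1" using ndvd by (auto simp: Legendre_def cong_0_iff split: if_splits)
      then show ?thesis
        using no_obstruction_prime_power[OF r(1), of a b c e] bqf_surj_mod_prime[OF r(1) True, of a b c]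
          bqf_isotropic_mod_prime[OF r(1) True, of a b c] ndvd unfolding D_def by blast
    next
      case leg: True
      have "e = 1"
      proof (rule ccontr)
        assume "e \<noteq> 1"
        then have "r ^ 2 \<le> r ^ e" using r(2) prime_gt_0_nat[OF r(1)] by (intro power_increasing) auto
        moreover have "(q_min D)\<^sup>2 \<le> r ^ 2" using q_min(4)[OF r(1) True leg] by (simp add: power_mono)
        moreover have "r ^ e < (q_min D)\<^sup>2" using r(3) by simp
        ultimately show False by linarith
      qed
      then show ?thesis using no_obstruction_prime[OF r(1) True] ndvd by (simp add: D_def)
    qed
  qed
  ultimately show ?thesis unfolding D_def[symmetric] by (intro min_obstruction_modulus_eqI)
qed

text \<open>\<open>T\<close> is the least obstructed power of 2: the norm form is onto modulo 4
  exactly when a quarter of the discriminant is 2 modulo 4, that is, when \<open>n = 3\<close>. It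
  competes with the odd prime divisors of \<open>m\<close>.\<close>

lemma min_obstruction_modulus_even_discr:
  fixes n m :: nat
  assumes prim: "primitive_bqf a b c" and n: "n \<ge> 2" and "m > 0" "odd m"
    and discr: "discr_bqf a b c = - (2 ^ n * int m)"
  defines "T \<equiv> (if n = 3 then 8 else 4)"
  shows "min_obstruction_modulus (bqf a b c)
    = enat (if m = 1 then T else min T (p_min (discr_bqf a b c)))"
proof -
  define D where "D = discr_bqf a b c"
  obtain i where i: "n = i + 2" using n by (metis add.commute le_Suc_ex)
  have D: "D = 4 * - (2 ^ i * int m)" by (simp add: D_def discr i)
  then have dvd: "4 dvd discr_bqf a b c" and quot: "discr_bqf a b c div 4 = - (2 ^ i * int m)"
    unfolding D_def by simp_all
  obtain j where j: "int m = 2 * j + 1" using \<open>odd m\<close> by (metis even_of_nat_iff oddE)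
  \<comment> \<open>The quotient is exactly divisible by \<open>2 ^ i\<close>, so it is 2 modulo 4
    only for \<open>i = 1\<close>.\<close>
  have mod4: "discr_bqf a b c div 4 mod 4 = 2 \<longleftrightarrow> n = 3"
  proof -
    consider "i = 0" | "i = 1" | k where "i = k + 2"
      by (metis add.commute le_Suc_ex One_nat_def less_2_cases not_less)
    then show ?thesis
    proof cases
      case 1
      then show ?thesis unfolding quot i j by simp presburger
    next
      case 2
      then show ?thesis unfolding quot i j by simp presburger
    next
      case (3 k)
      then have "- (2 ^ i * int m) = 4 * - (2 ^ k * int m)" by simp
      then show ?thesis unfolding quot i using 3 by simp
    qed
  qed
  have obs_T: "has_local_obstruction (bqf a b c) T"
    using obstruction_even_discr[OF prim dvd] norm_form_obstruction_4 norm_form_obstruction_8 mod4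
    by (auto simp: T_def)
  have two: "\<not> has_local_obstruction (bqf a b c) (2 ^ e)" if "e > 0" "2 ^ e < T" for e :: nat
  proof -
    have "e < 3"
    proof (rule ccontr)
      assume "\<not> e < 3"
      then have "(2::nat) ^ 3 \<le> 2 ^ e" by (intro power_increasing) auto
      then show False using that(2) by (simp add: T_def split: if_splits)
    qed
    then have "e = 1 \<or> e = 2" using that(1) by linarith
    then consider "e = 1" | "e = 2" by blast
    then show ?thesis
    proof cases
      case 1
      then show ?thesis using no_obstruction_2[OF prim] by simp
    next
      case 2
      then have "n = 3" using that(2) by (simp add: T_def split: if_splits)
      then show ?thesis using 2 no_obstruction_4[OF prim dvd] mod4 by simp
    qed
  qed
  have odd_dvd: "int p dvd D \<longleftrightarrow> p dvd m" if "prime p" "odd p" for p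
  proof -
    have "int p dvd D \<longleftrightarrow> int p dvd int (2 ^ n * m)" by (simp add: D_def discr)
    also have "\<dots> \<longleftrightarrow> p dvd 2 ^ n * m" by (simp only: int_dvd_int_iff)
    also have "\<dots> \<longleftrightarrow> p dvd m"
      using that prime_dvd_mult_iff[of p "2 ^ n" m] prime_dvd_power[of p 2 n]
        primes_dvd_imp_eq[of p 2] by auto
    finally show ?thesis .
  qed
  show ?thesis
  proof (cases "m = 1")
    case True
    then show ?thesis
      using obs_T two odd_dvd prime_nat_iff unfolding D_def
      by (auto intro!: min_obstruction_modulus_eqI_le_8 simp: T_def)
  next
    case False
    then obtain p where p: "prime p" "p dvd m" using prime_factor_nat by blast
    then have "odd p" using \<open>odd m\<close> dvd_trans by blast
    then have "int p dvd D" using odd_dvd p by blast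
    note P = p_min[OF p(1) \<open>odd p\<close> this]
    have "has_local_obstruction (bqf a b c) (p_min D)"
      using obstruction_dvd_discr P(1-3) prim by (simp add: D_def)
    then have "has_local_obstruction (bqf a b c) (min T (p_min D))"
      using obs_T by (simp add: min_def)
    moreover have "min T (p_min D) > 0" "min T (p_min D) \<le> 8"
      using P(1) prime_gt_0_nat by (auto simp: T_def)
    moreover have "\<not> int r dvd D" if "prime r" "odd r" "r < min T (p_min D)" for r
      using p_min(4)[OF that(1,2), of D] that(3) by linarith
    ultimately have "min_obstruction_modulus (bqf a b c) = enat (min T (p_min D))"
      using two by (intro min_obstruction_modulus_eqI_le_8) (simp_all add: D_def)
    then show ?thesis using False by (simp add: D_def)
  qed
qed

text \<open>The vector \<open>(b, - 2 * a)\<close> annihilates the square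
  \<open>(2 * a * x + b * y)\<^sup>2\<close>, so the form takes there the value \<open>- a\<close>
  times the discriminant.\<close>

lemma pos_def_discr_neg:
  assumes "pos_def_bqf a b c"
  shows "discr_bqf a b c < 0"
proof -
  have a: "a > 0" using assms[unfolded pos_def_bqf_def, rule_format, of 1 0] by (simp add: bqf_def)
  then have "bqf a b c b (- 2 * a) > 0"
    using assms by (simp add: pos_def_bqf_def)
  moreover have "bqf a b c b (- 2 * a) = a * - discr_bqf a b c"
    by (simp add: bqf_def discr_bqf_def power2_eq_square algebra_simps)
  ultimately show ?thesis using a by (simp add: mult_less_0_iff)
qed

lemma discr_mod_4: "4 dvd discr_bqf a b c \<or> [discr_bqf a b c = 1] (mod 4)"
proof -
  have "[discr_bqf a b c = b\<^sup>2] (mod 4)"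
    by (simp add: discr_bqf_def cong_iff_dvd_diff)
  then show ?thesis using square_mod_4[of b] by (auto simp: cong_def dvd_eq_mod_eq_0)
qed

lemma neg_discr_decompose:
  fixes D :: int
  assumes "D < 0" "4 dvd D"
  shows "\<exists>n m :: nat. n \<ge> 2 \<and> m > 0 \<and> odd m \<and> D = - (2 ^ n * int m)"
proof -
  define d where "d = nat (- D)"
  have "d > 0" "D = - int d" using assms(1) by (simp_all add: d_def)
  obtain m where m: "d = 2 ^ multiplicity 2 d * m" "odd m"
    using multiplicity_decompose'[of d 2] \<open>d > 0\<close> by auto
  have "int 4 dvd int d" using assms(2) \<open>D = - int d\<close> by simp
  then have "2\<^sup>2 dvd d" by (simp only: int_dvd_int_iff) simp
  then have "multiplicity 2 d \<ge> 2" using \<open>d > 0\<close> by (intro multiplicity_geI) auto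
  moreover have "D = - (2 ^ multiplicity 2 d * int m)"
    using \<open>D = - int d\<close> m(1) by (metis of_nat_mult of_nat_numeral of_nat_power)
  ultimately show ?thesis using m(2) odd_pos by blast
qed

lemma min_obstruction_modulus_eq_3:
  assumes "primitive_bqf a b c" "3 dvd discr_bqf a b c"
  shows "min_obstruction_modulus (bqf a b c) = 3"
proof -
  have "min_obstruction_modulus (bqf a b c) = enat 3"
  proof (rule min_obstruction_modulus_eqI_le_8)
    show "has_local_obstruction (bqf a b c) 3"
      using obstruction_dvd_discr[of 3] assms by simp
    show "\<not> has_local_obstruction (bqf a b c) (2 ^ e)" if "e > 0" "2 ^ e < (3::nat)" for e
    proof -
      have "e < 2" using that(2) power_increasing[of 2 e "2::nat"] by (cases "e < 2") auto
      then have "e = 1" using that(1) by simp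
      then show ?thesis using no_obstruction_2[OF assms(1)] by simp
    qed
    show "\<not> int p dvd discr_bqf a b c" if "prime p" "odd p" "p < 3" for p
      using odd_prime_gt_2[OF that(1,2)] that(3) by simp
  qed simp_all
  then show ?thesis by (simp add: numeral_eq_enat)
qed

lemma min_obstruction_modulus_eq_4:
  assumes "primitive_bqf a b c" "\<not> 3 dvd discr_bqf a b c" "[discr_bqf a b c = 5] (mod 8)"
  shows "min_obstruction_modulus (bqf a b c) = 4"
proof -
  have "min_obstruction_modulus (bqf a b c) = enat 4"
  proof (rule min_obstruction_modulus_eqI_le_8)
    show "has_local_obstruction (bqf a b c) 4" by (rule obstruction_4_odd_discr) fact
    show "\<not> has_local_obstruction (bqf a b c) (2 ^ e)" if "e > 0" "2 ^ e < (4::nat)" for e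
    proof -
      have "e < 2" using that(2) power_increasing[of 2 e "2::nat"] by (cases "e < 2") auto
      then have "e = 1" using that(1) by simp
      then show ?thesis using no_obstruction_2[OF assms(1)] by simp
    qed
    show "\<not> int p dvd discr_bqf a b c" if "prime p" "odd p" "p < 4" for p
    proof -
      have "p = 3" using odd_prime_gt_2[OF that(1,2)] that(3) by simp
      then show ?thesis using assms(2) by simp
    qed
  qed simp_all
  then show ?thesis by (simp add: numeral_eq_enat)
qed

theorem corollary1p3:
  fixes a b c \<Delta> :: int and \<kappa> :: enat
  assumes "primitive_bqf a b c"
    and "pos_def_bqf a b c"
    and "\<Delta> = discr_bqf a b c"
    and "\<kappa> = min_obstruction_modulus (bqf a b c)"
  shows
    "(\<forall>a' b' c'. primitive_bqf a' b' c' \<and> pos_def_bqf a' b' c' \<and> discr_bqf a' b' c' = \<Delta>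
        \<longrightarrow> min_obstruction_modulus (bqf a' b' c') = \<kappa>)
   \<and> (4 dvd \<Delta> \<longrightarrow>
        (\<exists>n m :: nat. n \<ge> 2 \<and> m > 0 \<and> odd m \<and> \<Delta> = - (2 ^ n * int m))
      \<and> (\<forall>n m :: nat. n \<ge> 2 \<and> m > 0 \<and> odd m \<and> \<Delta> = - (2 ^ n * int m) \<longrightarrow>
          \<kappa> = enat (if m = 1 \<and> n = 3 then 8
                     else if m = 1 \<and> n \<noteq> 3 then 4
                     else if m \<noteq> 1 \<and> n = 3 then min 8 (p_min \<Delta>)
                     else min 4 (p_min \<Delta>))))
   \<and> ([\<Delta> = 1] (mod 4) \<longrightarrow>
        (3 dvd \<Delta> \<longrightarrow> \<kappa> = 3)
      \<and> (\<not> 3 dvd \<Delta> \<and> [\<Delta> = 5] (mod 8) \<longrightarrow> \<kappa> = 4)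
      \<and> (\<not> 3 dvd \<Delta> \<and> [\<Delta> = 1] (mod 8) \<longrightarrow> \<kappa> = enat (min (p_min \<Delta>) ((q_min \<Delta>)\<^sup>2))))"
proof (intro conjI)
  have neg: "\<Delta> < 0" using pos_def_discr_neg assms by simp
  show "\<forall>a' b' c'. primitive_bqf a' b' c' \<and> pos_def_bqf a' b' c' \<and> discr_bqf a' b' c' = \<Delta>
    \<longrightarrow> min_obstruction_modulus (bqf a' b' c') = \<kappa>"
  proof (intro allI impI, elim conjE)
    fix a' b' c'
    assume prim: "primitive_bqf a' b' c'" and discr: "discr_bqf a' b' c' = \<Delta>"
    \<comment> \<open>The cases need only be exhaustive. In each one the formula involves the
      discriminant alone, so it gives the same modulus for both forms.\<close>
    consider "4 dvd \<Delta>" | "3 dvd \<Delta>" | "\<not> 3 dvd \<Delta>" "[\<Delta> = 5] (mod 8)" | "[\<Delta> = 1] (mod 8)"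
    proof -
      have "[\<Delta> = 5] (mod 8) \<or> [\<Delta> = 1] (mod 8)" if "[\<Delta> = 1] (mod 4)"
        using that unfolding cong_iff_dvd_diff by presburger
      then show ?thesis using that discr_mod_4[of a b c] assms(3) by blast
    qed
    then show "min_obstruction_modulus (bqf a' b' c') = \<kappa>"
    proof cases
      case 1
      then obtain n m where "n \<ge> 2" "m > 0" "odd m" "\<Delta> = - (2 ^ n * int m)"
        using neg_discr_decompose[OF neg] by blast
      then show ?thesis
        using min_obstruction_modulus_even_discr[of _ _ _ n m] prim discr assms by simp
    qed (use prim discr assms neg min_obstruction_modulus_eq_3 min_obstruction_modulus_eq_4
        min_obstruction_modulus_discr_1_mod_8 in simp_all)
  qed
  show "4 dvd \<Delta> \<longrightarrow>
        (\<exists>n m :: nat. n \<ge> 2 \<and> m > 0 \<and> odd m \<and> \<Delta> = - (2 ^ n * int m))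
      \<and> (\<forall>n m :: nat. n \<ge> 2 \<and> m > 0 \<and> odd m \<and> \<Delta> = - (2 ^ n * int m) \<longrightarrow>
          \<kappa> = enat (if m = 1 \<and> n = 3 then 8
                     else if m = 1 \<and> n \<noteq> 3 then 4
                     else if m \<noteq> 1 \<and> n = 3 then min 8 (p_min \<Delta>)
                     else min 4 (p_min \<Delta>)))"
  proof (intro impI conjI allI; (elim conjE)?)
    fix n m :: nat
    assume "n \<ge> 2" "m > 0" "odd m" "\<Delta> = - (2 ^ n * int m)"
    then show "\<kappa> = enat (if m = 1 \<and> n = 3 then 8
                     else if m = 1 \<and> n \<noteq> 3 then 4
                     else if m \<noteq> 1 \<and> n = 3 then min 8 (p_min \<Delta>)
                     else min 4 (p_min \<Delta>))"
      using min_obstruction_modulus_even_discr[of a b c n m] assms by simp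
  qed (use neg_discr_decompose[OF neg] in blast)
  show "[\<Delta> = 1] (mod 4) \<longrightarrow>
        (3 dvd \<Delta> \<longrightarrow> \<kappa> = 3)
      \<and> (\<not> 3 dvd \<Delta> \<and> [\<Delta> = 5] (mod 8) \<longrightarrow> \<kappa> = 4)
      \<and> (\<not> 3 dvd \<Delta> \<and> [\<Delta> = 1] (mod 8) \<longrightarrow> \<kappa> = enat (min (p_min \<Delta>) ((q_min \<Delta>)\<^sup>2)))"
    using assms neg min_obstruction_modulus_eq_3 min_obstruction_modulus_eq_4
      min_obstruction_modulus_discr_1_mod_8 by simp
qed

end
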